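(* Suppose that $F:\mathbb{R}\to\mathbb{R}$ is a smooth function and that its derivative $F_x$ has compact support. Let $0<t_\ast\le\infty$ and suppose that $\sigma_+,\sigma_-:[0,t_\ast)\to\mathbb{R}$ are smooth functions that satisfy $$\frac{d\sigma_+}{dt} + \frac{1}{2} \sigma_+^2 = \frac{d\sigma_-}{dt} + \frac{1}{2} \sigma_-^2\quad\text{on }[0,t_\ast),\qquad \sigma_+(0) - \sigma_-(0) = \int_{-\infty}^\infty F_x^2 \, dx.$$ Then there is a smooth solution $(u,v)$, defined in $-\infty<x<\infty$, $0\le t<t_\ast$, of the initial-boundary value problem $$(v_t+uv_x)_x=0,\qquad u_{xx}=v_x^2,$$ $$v(x,0)=F(x),\qquad u_x(\infty,t)=\sigma_+(t),\qquad u_x(-\infty,t)=\sigma_-(t).$$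
   Context: Here $u(x,t)$ and $v(x,t)$ are real-valued, subscripts denote partial derivatives, and $u_x(\pm\infty,t)$ denotes $\lim_{x\to\pm\infty}u_x(x,t)$. No uniqueness is claimed. *)

theory Defs
  imports "HOL-Analysis.Analysis"
begin

text \<open>
  Derivatives are taken within \<open>S\<close>, so at a boundary point of \<open>S\<close> they are one-sided. They are
  uniquely determined if \<open>S\<close> is convex with nonempty interior, which covers the domains used here:
  the line, an interval \<open>[0, T)\<close>, and the strip formed by their product. On the strip, smoothness
  means that partial derivatives of all orders exist and are continuous up to \<open>t = 0\<close>.
  The derivative is applied to each fixed direction \<open>h\<close> so that the type does not change in the
  recursion; in finite dimensions this is the usual notion of being \<open>k\<close> times continuously
  differentiable.
\<close>

primrec Ck_on ::
    "nat \<Rightarrow> ('a::euclidean_space \<Rightarrow> 'b::real_normed_vector) \<Rightarrow> 'a set \<Rightarrow> bool" where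
  "Ck_on 0 f S \<longleftrightarrow> continuous_on S f"
| "Ck_on (Suc k) f S \<longleftrightarrow>
     (\<exists>f'. (\<forall>x\<in>S. (f has_derivative f' x) (at x within S)) \<and> (\<forall>h. Ck_on k (\<lambda>x. f' x h) S))"

definition smooth_on :: "'a::euclidean_space set \<Rightarrow> ('a \<Rightarrow> 'b::real_normed_vector) \<Rightarrow> bool" where
  "smooth_on S f \<longleftrightarrow> (\<forall>k. Ck_on k f S)"

text \<open>The extended real \<open>T\<close> allows \<open>T = \<infinity>\<close>.\<close>

definition time_interval :: "ereal \<Rightarrow> real set" where
  "time_interval T = {t. 0 \<le> t \<and> ereal t < T}"

definition dx :: "(real \<Rightarrow> real \<Rightarrow> real) \<Rightarrow> real \<Rightarrow> real \<Rightarrow> real" where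
  "dx w x t = deriv (\<lambda>y. w y t) x"

text \<open>Time derivatives on \<open>[0, T)\<close> are one-sided at \<open>t = 0\<close>.\<close>

definition ddt :: "ereal \<Rightarrow> (real \<Rightarrow> real) \<Rightarrow> real \<Rightarrow> real" where
  "ddt T \<sigma> t = vector_derivative \<sigma> (at t within time_interval T)"

definition dt :: "ereal \<Rightarrow> (real \<Rightarrow> real \<Rightarrow> real) \<Rightarrow> real \<Rightarrow> real \<Rightarrow> real" where
  "dt T w x t = ddt T (w x) t"

end

theory Submission
  imports Defs
begin

text \<open>
  Follow the characteristics \<open>X\<^sub>t = u(X, t)\<close>, \<open>X(\<xi>, 0) = \<xi>\<close>, and look for \<open>v\<close> constant along them,
  so that \<open>v(X(\<xi>, t), t) = F(\<xi>)\<close>. Differentiating \<open>u\<^sub>x\<^sub>x = v\<^sub>x\<^sup>2\<close> in time shows that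
  \<open>d/dt u\<^sub>x + u\<^sub>x\<^sup>2/2\<close> takes the same value \<open>k(t)\<close> on all characteristics, so \<open>u\<^sub>x = 2 y\<^sub>t / y\<close> for a
  solution \<open>y(\<xi>, t)\<close> of the linear equation \<open>y\<^sub>t\<^sub>t = (k/2) y\<close>, and \<open>X\<^sub>\<xi> = y\<^sup>2\<close>. The boundary data give
  the solutions \<open>a = exp (\<integral>\<sigma>m/2)\<close> and \<open>b = exp (\<integral>\<sigma>p/2)\<close>, and \<open>y = (1 - \<theta>(\<xi>)) a + \<theta>(\<xi>) b\<close>, where
  \<open>\<theta>\<close> is the fraction of the energy \<open>S = \<integral>F\<^sub>x\<^sup>2\<close> to the left of \<open>\<xi>\<close>. As a convex combination \<open>y\<close>
  stays positive, so \<open>X(\<cdot>, t)\<close> has a smooth inverse for all \<open>t\<close>, and \<open>u\<^sub>x\<^sub>x = v\<^sub>x\<^sup>2\<close> reduces to the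
  Wronskian identity \<open>a b (\<sigma>p - \<sigma>m) = S\<close>.
\<close>

subsection \<open>Calculus of \<open>k\<close> times differentiable functions\<close>

lemma Ck_on_cong:
  assumes "Ck_on k f S" "\<And>x. x \<in> S \<Longrightarrow> f x = g x"
  shows "Ck_on k g S"
proof (cases k)
  case 0
  then show ?thesis using assms by (simp cong: continuous_on_cong)
next
  case (Suc j)
  with assms(1) obtain f' where f': "\<And>x. x \<in> S \<Longrightarrow> (f has_derivative f' x) (at x within S)"
    "\<And>h. Ck_on j (\<lambda>x. f' x h) S"
    by auto
  have "(g has_derivative f' x) (at x within S)" if "x \<in> S" for x
    using has_derivative_transform[OF that _ f'(1)[OF that], of g] assms(2) by simp
  with f'(2) Suc show ?thesis by auto
qed

lemma Ck_on_continuous_on: "Ck_on k f S \<Longrightarrow> continuous_on S f"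
  by (cases k) (auto simp: continuous_on_eq_continuous_within intro: has_derivative_continuous)

lemma Ck_on_SucD: "Ck_on (Suc k) f S \<Longrightarrow> Ck_on k f S"
proof (induction k arbitrary: f)
  case 0
  then show ?case using Ck_on_continuous_on by (metis Ck_on.simps(1))
next
  case (Suc k)
  then show ?case by (metis Ck_on.simps(2))
qed

lemma Ck_on_const: "Ck_on k (\<lambda>x. c) S"
proof (induction k arbitrary: c)
  case (Suc k)
  then show ?case by (auto intro!: exI[of _ "\<lambda>x h. 0"])
qed simp

lemma Ck_on_linear: "bounded_linear f \<Longrightarrow> Ck_on k f S"
  by (cases k) (auto simp: Ck_on_const linear_continuous_on
      intro!: exI[of _ "\<lambda>x. f"] bounded_linear_imp_has_derivative)

lemma Ck_on_add:
  assumes "Ck_on k f S" "Ck_on k g S"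
  shows "Ck_on k (\<lambda>x. f x + g x) S"
  using assms
proof (induction k arbitrary: f g)
  case (Suc k)
  from Suc.prems obtain f' g' where
    "\<forall>x\<in>S. (f has_derivative f' x) (at x within S)" "\<And>h. Ck_on k (\<lambda>x. f' x h) S"
    "\<forall>x\<in>S. (g has_derivative g' x) (at x within S)" "\<And>h. Ck_on k (\<lambda>x. g' x h) S"
    by auto
  then show ?case
    by (auto intro!: exI[of _ "\<lambda>x h. f' x h + g' x h"] Suc.IH has_derivative_add)
qed (auto intro!: continuous_intros)

lemma Ck_on_sum:
  assumes "\<And>i. i \<in> A \<Longrightarrow> Ck_on k (f i) S"
  shows "Ck_on k (\<lambda>x. \<Sum>i\<in>A. f i x) S"
  using assms by (induction A rule: infinite_finite_induct) (auto intro: Ck_on_const Ck_on_add)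

text \<open>A single product rule for scalar multiples, inner products and real products. The
  derivative is a sum of two terms \<open>B\<close>, each with one factor differentiated; the
  undifferentiated factor is lowered to order \<open>k\<close> so that the induction hypothesis
  covers both terms.\<close>

lemma Ck_on_bilinear:
  assumes "bounded_bilinear B" "Ck_on k f S" "Ck_on k g S"
  shows "Ck_on k (\<lambda>x. B (f x) (g x)) S"
  using assms(2,3)
proof (induction k arbitrary: f g)
  case 0
  then show ?case using bounded_bilinear.continuous_on[OF assms(1)] by auto
next
  case (Suc k)
  from Suc.prems obtain f' g' where
    "\<forall>x\<in>S. (f has_derivative f' x) (at x within S)" "\<And>h. Ck_on k (\<lambda>x. f' x h) S"
    "\<forall>x\<in>S. (g has_derivative g' x) (at x within S)" "\<And>h. Ck_on k (\<lambda>x. g' x h) S"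
    by auto
  moreover have "Ck_on k f S" "Ck_on k g S"
    using Suc.prems Ck_on_SucD by blast+
  ultimately show ?case
    by (auto intro!: exI[of _ "\<lambda>x h. B (f x) (g' x h) + B (f' x h) (g x)"] Suc.IH Ck_on_add
        bounded_bilinear.FDERIV[OF assms(1)])
qed

lemmas Ck_on_scaleR = Ck_on_bilinear[OF bounded_bilinear_scaleR]
lemmas Ck_on_inner = Ck_on_bilinear[OF bounded_bilinear_inner]

lemma Ck_on_mult:
  fixes f g :: "'a::euclidean_space \<Rightarrow> real"
  assumes "Ck_on k f S" "Ck_on k g S"
  shows "Ck_on k (\<lambda>x. f x * g x) S"
  using Ck_on_bilinear[OF bounded_bilinear_mult assms] .

lemma Ck_on_minus:
  fixes f :: "'a::euclidean_space \<Rightarrow> real"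
  shows "Ck_on k f S \<Longrightarrow> Ck_on k (\<lambda>x. - f x) S"
  using Ck_on_mult[OF Ck_on_const[of _ "-1"]] by fastforce

lemma Ck_on_diff:
  fixes f g :: "'a::euclidean_space \<Rightarrow> real"
  shows "Ck_on k f S \<Longrightarrow> Ck_on k g S \<Longrightarrow> Ck_on k (\<lambda>x. f x - g x) S"
  using Ck_on_add[OF _ Ck_on_minus] by fastforce

lemma Ck_on_power:
  fixes f :: "'a::euclidean_space \<Rightarrow> real"
  shows "Ck_on k f S \<Longrightarrow> Ck_on k (\<lambda>x. f x ^ n) S"
  by (induction n) (auto intro: Ck_on_const Ck_on_mult)

text \<open>The derivative of \<open>inverse f\<close> is a polynomial in \<open>inverse f\<close>
  and \<open>f'\<close>, so regularity of order \<open>k\<close> reproduces itself at order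
  \<open>k + 1\<close>.\<close>

lemma Ck_on_inverse:
  fixes f :: "'a::euclidean_space \<Rightarrow> real"
  assumes "Ck_on k f S" "\<And>x. x \<in> S \<Longrightarrow> f x \<noteq> 0"
  shows "Ck_on k (\<lambda>x. inverse (f x)) S"
  using assms
proof (induction k)
  case (Suc k)
  from Suc.prems obtain f' where f':
    "\<forall>x\<in>S. (f has_derivative f' x) (at x within S)" "\<And>h. Ck_on k (\<lambda>x. f' x h) S"
    by auto
  have "Ck_on k (\<lambda>x. inverse (f x)) S"
    using Suc Ck_on_SucD by blast
  with f' Suc.prems(2) show ?case
    by (auto intro!: exI[of _ "\<lambda>x h. - (inverse (f x) * f' x h * inverse (f x))"] 
        has_derivative_inverse Ck_on_minus Ck_on_mult)
qed (auto intro!: continuous_intros)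

lemma Ck_on_divide:
  fixes f g :: "'a::euclidean_space \<Rightarrow> real"
  assumes "Ck_on k f S" "Ck_on k g S" "\<And>x. x \<in> S \<Longrightarrow> g x \<noteq> 0"
  shows "Ck_on k (\<lambda>x. f x / g x) S"
  unfolding divide_inverse using assms by (intro Ck_on_mult Ck_on_inverse)

lemma Ck_on_Pair:
  assumes "Ck_on k f S" "Ck_on k g S"
  shows "Ck_on k (\<lambda>x. (f x, g x)) S"
  using assms
proof (induction k arbitrary: f g)
  case (Suc k)
  from Suc.prems obtain f' g' where
    "\<forall>x\<in>S. (f has_derivative f' x) (at x within S)" "\<And>h. Ck_on k (\<lambda>x. f' x h) S"
    "\<forall>x\<in>S. (g has_derivative g' x) (at x within S)" "\<And>h. Ck_on k (\<lambda>x. g' x h) S"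
    by auto
  then show ?case
    by (auto intro!: exI[of _ "\<lambda>x h. (f' x h, g' x h)"] Suc.IH has_derivative_Pair)
qed (auto intro!: continuous_intros)

text \<open>In the chain rule \<open>g'\<close> is applied to the direction \<open>f' x h\<close>,
  which varies with \<open>x\<close>, whereas \<open>Ck_on\<close> controls \<open>g'\<close> only
  in fixed directions. Expanding \<open>f' x h\<close> in the basis writes the derivative as a
  finite sum of scalar functions times \<open>g' (f x) b\<close> with \<open>b\<close> fixed, and
  the induction hypothesis applies to each of these.\<close>

lemma Ck_on_compose:
  fixes f :: "'a::euclidean_space \<Rightarrow> 'b::euclidean_space"
    and g :: "'b \<Rightarrow> 'c::real_normed_vector"
  assumes "Ck_on k g V" "Ck_on k f S" "\<And>x. x \<in> S \<Longrightarrow> f x \<in> V"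
  shows "Ck_on k (\<lambda>x. g (f x)) S"
  using assms(1,2)
proof (induction k arbitrary: g)
  case 0
  then show ?case using assms(3) by (auto intro: continuous_on_compose2)
next
  case (Suc k)
  from Suc.prems obtain f' g' where d:
    "\<And>x. x\<in>S \<Longrightarrow> (f has_derivative f' x) (at x within S)" "\<And>h. Ck_on k (\<lambda>x. f' x h) S"
    "\<And>x. x\<in>V \<Longrightarrow> (g has_derivative g' x) (at x within V)" "\<And>h. Ck_on k (\<lambda>x. g' x h) V"
    unfolding Ck_on.simps by metis
  have f: "Ck_on k f S"
    using Suc.prems(2) by (rule Ck_on_SucD)
  have "Ck_on k (\<lambda>x. g' (f x) (f' x h)) S" for h
  proof (rule Ck_on_cong)
    show "Ck_on k (\<lambda>x. \<Sum>b\<in>Basis. (f' x h \<bullet> b) *\<^sub>R g' (f x) b) S"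
      by (intro Ck_on_sum Ck_on_scaleR Ck_on_inner Ck_on_const d Suc.IH f)
    fix x assume "x \<in> S"
    then have "linear (g' (f x))"
      using d(3) assms(3) has_derivative_linear by blast
    then show "(\<Sum>b\<in>Basis. (f' x h \<bullet> b) *\<^sub>R g' (f x) b) = g' (f x) (f' x h)"
      by (subst (3) euclidean_representation[symmetric]) (simp add: linear_sum linear_scale)
  qed
  moreover have "((\<lambda>x. g (f x)) has_derivative (\<lambda>h. g' (f x) (f' x h))) (at x within S)"
    if "x \<in> S" for x
    using has_derivative_in_compose2[of V g g', OF d(3) _ that d(1)[OF that]] assms(3) by blast
  ultimately show ?case
    unfolding Ck_on.simps by (intro exI[of _ "\<lambda>x h. g' (f x) (f' x h)"]) blast
qed

section \<open>Functions of one real variable: exponential and antiderivatives\<close>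

lemma Ck_on_SucI:
  fixes f :: "real \<Rightarrow> real"
  assumes "\<And>x. x \<in> S \<Longrightarrow> (f has_real_derivative g x) (at x within S)" "Ck_on k g S"
  shows "Ck_on (Suc k) f S"
  unfolding Ck_on.simps
proof (intro exI conjI ballI allI)
  show "(f has_derivative (*) (g x)) (at x within S)" if "x \<in> S" for x
    using assms(1)[OF that] by (simp add: has_field_derivative_def)
  show "Ck_on k (\<lambda>x. g x * h) S" for h
    by (intro Ck_on_mult Ck_on_const assms(2))
qed

lemma Ck_on_exp: "Ck_on k (exp :: real \<Rightarrow> real) S"
proof (induction k)
  case (Suc k)
  then show ?case
    by (rule Ck_on_SucI[rotated]) (rule has_field_derivative_at_within[OF DERIV_exp])
qed (simp add: continuous_on_exp[OF continuous_on_id])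

lemma smooth_on_antiderivative:
  fixes f :: "real \<Rightarrow> real"
  assumes "\<And>x. x \<in> S \<Longrightarrow> (f has_real_derivative g x) (at x within S)" "smooth_on S g"
  shows "smooth_on S f"
  unfolding smooth_on_def
proof
  fix k
  show "Ck_on k f S"
    by (rule Ck_on_SucD, rule Ck_on_SucI, erule assms(1))
      (use assms(2) in \<open>simp add: smooth_on_def\<close>)
qed

text \<open>Serves both the whole line and \<open>[0, T)\<close>. Near each point the claim is
  reduced to the fundamental theorem on a compact interval that contains \<open>c\<close> and is a
  neighbourhood of the point relative to \<open>S\<close>; there \<open>g\<close> is an indefinite
  integral up to a constant.\<close>

lemma antiderivative_on_interval:
  fixes f :: "real \<Rightarrow> real"
  assumes "is_interval S" "continuous_on S f" "c \<in> S"
  obtains g where "g c = 0" "\<And>x. x \<in> S \<Longrightarrow> (g has_real_derivative f x) (at x within S)"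
proof -
  define g where "g x = (if c \<le> x then integral {c..x} f else - integral {x..c} f)" for x
  show ?thesis
  proof (rule that[of g])
    show "g c = 0" by (simp add: g_def)
    fix x assume x: "x \<in> S"
    \<comment> \<open>The point \<open>a\<close> lies strictly left of \<open>x\<close> unless
      \<open>x\<close> is the least element of \<open>S\<close>; \<open>b\<close> is chosen likewise
      on the right. Hence \<open>{a..b}\<close> and \<open>S\<close> agree near
      \<open>x\<close>.\<close>
    obtain a where a: "a \<in> S" "a \<le> x" "a \<le> c" "a = x \<Longrightarrow> \<forall>z\<in>S. x \<le> z"
    proof (cases "\<exists>y\<in>S. y < x")
      case True
      then obtain y where "y \<in> S" "y < x" by blast
      then have "min y c \<in> S" "min y c < x"
        using assms(3) by (simp_all add: min_def)
      then show ?thesis by (intro that[of "min y c"]) simp_all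
    next
      case False
      then show ?thesis using that[of x] x assms(3) by force
    qed
    obtain b where b: "b \<in> S" "x \<le> b" "c \<le> b" "b = x \<Longrightarrow> \<forall>z\<in>S. z \<le> x"
    proof (cases "\<exists>y\<in>S. y > x")
      case True
      then obtain y where "y \<in> S" "y > x" by blast
      then have "max y c \<in> S" "x < max y c"
        using assms(3) by (simp_all add: max_def)
      then show ?thesis by (intro that[of "max y c"]) simp_all
    next
      case False
      then show ?thesis using that[of x] x assms(3) by force
    qed
    have sub: "{a..b} \<subseteq> S"
      using mem_is_interval_1_I[OF assms(1) a(1) b(1)] by (simp add: subset_iff)
    then have cont: "continuous_on {a..b} f"
      using assms(2) continuous_on_subset by blast
    have int: "f integrable_on {l..r}" if "{l..r} \<subseteq> {a..b}" for l r
      using cont that by (meson continuous_on_subset integrable_continuous_real)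
    have g: "g y = integral {a..y} f - integral {a..c} f" if "y \<in> {a..b}" for y
    proof (cases "c \<le> y")
      case True
      then have "integral {a..c} f + integral {c..y} f = integral {a..y} f"
        using a(3) that by (intro Henstock_Kurzweil_Integration.integral_combine int) auto
      then show ?thesis using True by (simp add: g_def)
    next
      case False
      then have "integral {a..y} f + integral {y..c} f = integral {a..c} f"
        using b(3) that by (intro Henstock_Kurzweil_Integration.integral_combine int) auto
      then show ?thesis using False by (simp add: g_def)
    qed
    have xab: "x \<in> {a..b}" using a b by auto
    have "((\<lambda>y. integral {a..y} f - integral {a..c} f) has_vector_derivative f x) (at x within {a..b})"
      using integral_has_vector_derivative[OF cont xab] by (auto intro!: derivative_eq_intros)
    then have "(g has_real_derivative f x) (at x within {a..b})"
      unfolding has_real_derivative_iff_has_vector_derivative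
      by (rule has_vector_derivative_transform[OF xab g, rotated])
    \<comment> \<open>If \<open>x\<close> is an endpoint of \<open>S\<close>, moving that side of
      the window by 1 keeps it an open set around \<open>x\<close> without admitting further points
      of \<open>S\<close>.\<close>
    moreover have "at x within {a..b} = at x within S"
    proof (rule at_within_nhd)
      show "x \<in> {(if a = x then x - 1 else a)<..<(if b = x then x + 1 else b)}"
        using xab by auto
      show "{a..b} \<inter> {(if a = x then x - 1 else a)<..<(if b = x then x + 1 else b)} - {x} =
        S \<inter> {(if a = x then x - 1 else a)<..<(if b = x then x + 1 else b)} - {x}"
        using sub a(4) b(4) by (fastforce split: if_splits)
    qed auto
    ultimately show "(g has_real_derivative f x) (at x within S)" by simp
  qed
qed

subsection \<open>Inverting a family of diffeomorphisms of the line\<close>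

text \<open>Inverse function rule relative to sets, so that it also covers the boundary
  \<open>t = 0\<close> of the strip. With \<open>k = g z - g y\<close>, applying \<open>g'\<close>
  to the linearization error of \<open>f\<close> at \<open>k\<close> gives exactly
  \<open>g' (z - y) - k\<close>. Continuity of \<open>g\<close> makes \<open>k\<close> small, and
  the error bound for \<open>f\<close> then passes to \<open>g\<close>.\<close>

lemma has_derivative_inverse_within:
  fixes f :: "'a::real_normed_vector \<Rightarrow> 'b::real_normed_vector"
  assumes derf: "(f has_derivative f') (at (g y) within S)"
    and g': "bounded_linear g'" "\<And>x. g' (f' x) = x"
    and contg: "continuous (at y within V) g"
    and y: "y \<in> V"
    and fg: "\<And>z. z \<in> V \<Longrightarrow> g z \<in> S \<and> f (g z) = z"
  shows "(g has_derivative g') (at y within V)"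
  unfolding has_derivative_within_alt
proof (intro conjI allI impI g')
  fix \<epsilon> :: real assume "0 < \<epsilon>"
  obtain C where C: "0 < C" "\<And>x. norm (g' x) \<le> norm x * C"
    using bounded_linear.pos_bounded[OF g'(1)] by blast
  \<comment> \<open>The first term gives \<open>C * e \<le> 1 / 2\<close>, which absorbs the error
    and yields \<open>norm ?k \<le> 2 * C * norm (z - y)\<close>. The second gives
    \<open>2 * C\<^sup>2 * e \<le> \<epsilon>\<close>, which turns this into the required
    estimate.\<close>
  define e where "e = min (1 / (2 * C)) (\<epsilon> / (2 * C\<^sup>2))"
  have e: "0 < e" "C * e \<le> 1 / 2" "2 * C\<^sup>2 * e \<le> \<epsilon>"
    using C(1) \<open>0 < \<epsilon>\<close> by (auto simp: e_def min_def field_simps power2_eq_square)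
  obtain r where r: "0 < r" "\<And>q. q \<in> S \<Longrightarrow> norm (q - g y) < r \<Longrightarrow>
      norm (f q - f (g y) - f' (q - g y)) \<le> e * norm (q - g y)"
    using derf e(1) unfolding has_derivative_within_alt by blast
  obtain d where d: "0 < d" "\<And>z. z \<in> V \<Longrightarrow> norm (z - y) < d \<Longrightarrow> norm (g z - g y) < r"
    using contg r(1) unfolding continuous_within_eps_delta dist_norm by blast
  have "norm (g z - g y - g' (z - y)) \<le> \<epsilon> * norm (z - y)" if z: "z \<in> V" "norm (z - y) < d" for z
  proof -
    let ?k = "g z - g y"
    have "g' (z - y - f' ?k) = g' (z - y) - ?k"
      using g' by (simp add: linear_diff bounded_linear.linear)
    then have "norm (?k - g' (z - y)) \<le> norm (z - y - f' ?k) * C"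
      using C(2)[of "z - y - f' ?k"] by (simp add: norm_minus_commute)
    also have "\<dots> \<le> (e * norm ?k) * C"
      using r(2)[of "g z"] d(2)[OF z] fg y z(1) C(1) by (intro mult_right_mono) auto
    finally have 1: "norm (?k - g' (z - y)) \<le> C * e * norm ?k" by (simp add: mult_ac)
    have "norm ?k \<le> norm (?k - g' (z - y)) + norm (g' (z - y))"
      using norm_triangle_sub by (metis add.commute)
    moreover have "C * e * norm ?k \<le> 1 / 2 * norm ?k"
      using e(2) by (intro mult_right_mono) auto
    ultimately have "norm ?k \<le> 2 * C * norm (z - y)"
      using 1 C(2)[of "z - y"] by (simp add: mult_ac)
    then have "C * e * norm ?k \<le> C * e * (2 * C * norm (z - y))"
      using C(1) e(1) by (intro mult_left_mono) auto
    also have "\<dots> = 2 * C\<^sup>2 * e * norm (z - y)" by (simp add: power2_eq_square)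
    also have "\<dots> \<le> \<epsilon> * norm (z - y)"
      using e(3) by (intro mult_right_mono) auto
    finally show ?thesis using 1 by linarith
  qed
  then show "\<exists>d>0. \<forall>z\<in>V. norm (z - y) < d \<longrightarrow> norm (g z - g y - g' (z - y)) \<le> \<epsilon> * norm (z - y)"
    using d(1) by blast
qed

section \<open>Partial derivatives on the strip\<close>

lemma has_derivative_imp_has_real_derivative:
  assumes "(f has_derivative f') (at x within S)"
  shows "(f has_real_derivative f' 1) (at x within S)"
proof (rule has_derivative_imp_has_field_derivative[OF assms])
  show "h * f' 1 = f' h" for h
    using linear_scale[OF has_derivative_linear[OF assms], of h 1] by simp
qed

lemma partial_derivative_fst:
  fixes G :: "real \<times> real \<Rightarrow> real"
  assumes "(G has_derivative G') (at (x, t) within UNIV \<times> I)" "t \<in> I"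
  shows "((\<lambda>y. G (y, t)) has_real_derivative G' (1, 0)) (at x)"
proof -
  have "((\<lambda>y. (y, t)) has_derivative (\<lambda>h. (h, 0))) (at x)"
    by (intro has_derivative_Pair has_derivative_ident has_derivative_const)
  moreover have "(G has_derivative G') (at (x, t) within range (\<lambda>y. (y, t)))"
    using assms by (auto intro: has_derivative_subset)
  ultimately have "((\<lambda>y. G (y, t)) has_derivative (\<lambda>h. G' (h, 0))) (at x)"
    using has_derivative_in_compose by fastforce
  then show ?thesis by (rule has_derivative_imp_has_real_derivative)
qed

lemma partial_derivative_snd:
  fixes G :: "real \<times> real \<Rightarrow> real"
  assumes "(G has_derivative G') (at (x, t) within UNIV \<times> I)" "t \<in> I"
  shows "((\<lambda>s. G (x, s)) has_real_derivative G' (0, 1)) (at t within I)"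
proof -
  have "((\<lambda>s. (x, s)) has_derivative (\<lambda>h. (0, h))) (at t within I)"
    by (intro has_derivative_Pair has_derivative_ident has_derivative_const)
  moreover have "(G has_derivative G') (at (x, t) within (\<lambda>s. (x, s)) ` I)"
    using assms by (auto intro: has_derivative_subset)
  ultimately have "((\<lambda>s. G (x, s)) has_derivative (\<lambda>h. G' (0, h))) (at t within I)"
    using has_derivative_in_compose by fastforce
  then show ?thesis by (rule has_derivative_imp_has_real_derivative)
qed

lemma has_derivative_fst_compose:
  fixes f :: "real \<Rightarrow> real"
  assumes "(f has_real_derivative f') (at (fst p))"
  shows "((\<lambda>p. f (fst p)) has_derivative (\<lambda>h. f' * fst h)) (at p within UNIV \<times> I)"
  using has_derivative_compose[OF has_derivative_fst[OF has_derivative_ident]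
      assms[unfolded has_field_derivative_def]] .

lemma has_derivative_snd_compose:
  fixes f :: "real \<Rightarrow> real"
  assumes "(f has_real_derivative f') (at (snd p) within I)"
  shows "((\<lambda>p. f (snd p)) has_derivative (\<lambda>h. f' * snd h)) (at p within UNIV \<times> I)"
proof (rule has_derivative_in_compose[of snd snd p "UNIV \<times> I" f "\<lambda>h. f' * h"])
  show "(f has_derivative (*) f') (at (snd p) within snd ` (UNIV \<times> I))"
    using assms by (auto simp: has_field_derivative_def intro: has_derivative_subset)
qed (rule has_derivative_snd[OF has_derivative_ident])

text \<open>The bound \<open>m t\<close> makes each \<open>X (\<cdot>, t)\<close> expand distances
  by at least \<open>m t\<close>, which gives injectivity, surjectivity and, through continuity of
  \<open>m\<close>, joint continuity of the inverse. The inverse rule then yields derivatives, and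
  their formula gives smoothness by bootstrapping.\<close>

lemma parametric_inverse:
  fixes X J U :: "real \<times> real \<Rightarrow> real"
  assumes X: "\<And>p. p \<in> UNIV \<times> I \<Longrightarrow>
      (X has_derivative (\<lambda>h. J p * fst h + U p * snd h)) (at p within UNIV \<times> I)"
    and J: "smooth_on (UNIV \<times> I) J" and U: "smooth_on (UNIV \<times> I) U"
    and m: "continuous_on I m" "\<And>t. t \<in> I \<Longrightarrow> 0 < m t" "\<And>x t. t \<in> I \<Longrightarrow> m t \<le> J (x, t)"
  obtains \<Xi> where "smooth_on (UNIV \<times> I) \<Xi>"
    and "\<And>x t. t \<in> I \<Longrightarrow> X (\<Xi> (x, t), t) = x"
    and "\<And>x t. t \<in> I \<Longrightarrow> \<Xi> (X (x, t), t) = x"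
    and "\<And>x t. t \<in> I \<Longrightarrow> ((\<lambda>y. \<Xi> (y, t)) has_real_derivative 1 / J (\<Xi> (x, t), t)) (at x)"
    and "\<And>x t. t \<in> I \<Longrightarrow> ((\<lambda>s. \<Xi> (x, s)) has_real_derivative
            - U (\<Xi> (x, t), t) / J (\<Xi> (x, t), t)) (at t within I)"
    and "\<And>t. t \<in> I \<Longrightarrow> filterlim (\<lambda>x. \<Xi> (x, t)) at_top at_top"
    and "\<And>t. t \<in> I \<Longrightarrow> filterlim (\<lambda>x. \<Xi> (x, t)) at_bot at_bot"
proof -
  have dX: "((\<lambda>y. X (y, t)) has_real_derivative J (x, t)) (at x)" if "t \<in> I" for x t
    using partial_derivative_fst[OF X that, of x] that by simp
  have expand: "m t * (b - a) \<le> X (b, t) - X (a, t)" if t: "t \<in> I" and ab: "a \<le> b" for t a b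
  proof (cases "a = b")
    case False
    with ab obtain z where "X (b, t) - X (a, t) = (b - a) * J (z, t)"
      using MVT2[of a b "\<lambda>y. X (y, t)" "\<lambda>y. J (y, t)"] dX[OF t] by auto
    then show ?thesis
      using mult_right_mono[OF m(3)[OF t, of z], of "b - a"] ab by (simp add: mult.commute)
  qed simp
  have expand_abs: "m t * \<bar>b - a\<bar> \<le> \<bar>X (b, t) - X (a, t)\<bar>" if "t \<in> I" for t a b
    using expand[OF that, of a b] expand[OF that, of b a] by (cases "a \<le> b") auto
  have surj: "\<exists>y. X (y, t) = x" if t: "t \<in> I" for x t
  proof -
    \<comment> \<open>By \<open>expand\<close>, moving from 0 to \<open>R\<close> or to
      \<open>- R\<close> changes \<open>X\<close> by at least \<open>m t * R\<close>, the distance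
      from \<open>X (0, t)\<close> to \<open>x\<close>. The values at the two ends therefore enclose
      \<open>x\<close>.\<close>
    define R where "R = \<bar>x - X (0, t)\<bar> / m t"
    have R: "0 \<le> R" "m t * R = \<bar>x - X (0, t)\<bar>"
      using m(2)[OF t] by (auto simp: R_def)
    have "X (- R, t) \<le> x" "x \<le> X (R, t)"
      using expand[OF t, of 0 R] expand[OF t, of "- R" 0] R by auto
    moreover have "continuous_on {- R..R} (\<lambda>y. X (y, t))"
      using dX[OF t] by (intro DERIV_continuous_on) (blast intro: has_field_derivative_at_within)
    ultimately show ?thesis
      using IVT'[of "\<lambda>y. X (y, t)" "- R" x R] R(1) by auto
  qed
  define \<Xi> where "\<Xi> p = (SOME y. X (y, snd p) = fst p)" for p
  have X\<Xi>: "X (\<Xi> (x, t), t) = x" if "t \<in> I" for x t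
    using someI_ex[OF surj[OF that]] by (simp add: \<Xi>_def)
  have inj: "a = b" if "t \<in> I" "X (a, t) = X (b, t)" for a b t
    using expand_abs[OF that(1), of b a] m(2)[OF that(1)] that(2) by (auto simp: mult_le_0_iff)
  have \<Xi>X: "\<Xi> (X (x, t), t) = x" if "t \<in> I" for x t
    using inj[OF that] X\<Xi>[OF that] by blast
  have mono: "X (a, t) \<le> X (b, t)" if "t \<in> I" "a \<le> b" for a b t
    using expand[OF that] m(2)[OF that(1)] that(2)
    by (smt (verit) mult_nonneg_nonneg)
  have contX: "continuous_on (UNIV \<times> I) X"
    unfolding continuous_on_eq_continuous_within using X has_derivative_continuous by blast
  \<comment> \<open>Expansion bounds the change of \<open>\<Xi>\<close> from \<open>p\<close> to
    \<open>q\<close> by the distance of \<open>fst q\<close> from \<open>X (\<Xi> p, snd q)\<close>,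
    divided by \<open>m (snd q)\<close>. Only the fixed value \<open>\<Xi> p\<close> occurs in this
    bound, so continuity of \<open>X\<close> and \<open>m\<close> sends it to 0.\<close>
  have cont\<Xi>: "continuous_on (UNIV \<times> I) \<Xi>"
    unfolding continuous_on_def
  proof
    fix p :: "real \<times> real" assume p: "p \<in> UNIV \<times> I"
    obtain x t where xt: "p = (x, t)" "t \<in> I" using p by auto
    let ?F = "at p within UNIV \<times> I"
    have snd: "(snd \<longlongrightarrow> t) ?F" and fst: "(fst \<longlongrightarrow> x) ?F"
      using tendsto_snd[OF tendsto_ident_at, of p "UNIV \<times> I"]
        tendsto_fst[OF tendsto_ident_at, of p "UNIV \<times> I"] xt by auto
    have ev: "\<forall>\<^sub>F q in ?F. q \<in> UNIV \<times> I"
      by (simp add: eventually_at_filter)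
    have mt: "((\<lambda>q. m (snd q)) \<longlongrightarrow> m t) ?F"
      using ev by (intro continuous_on_tendsto_compose[OF m(1) snd xt(2)]) (auto elim!: eventually_mono)
    have "((\<lambda>q. (\<Xi> p, snd q)) \<longlongrightarrow> (\<Xi> p, t)) ?F"
      by (intro tendsto_intros snd)
    then have "((\<lambda>q. X (\<Xi> p, snd q)) \<longlongrightarrow> X (\<Xi> p, t)) ?F"
      using xt(2) ev by (elim continuous_on_tendsto_compose[OF contX]) (auto elim!: eventually_mono)
    then have "((\<lambda>q. \<bar>fst q - X (\<Xi> p, snd q)\<bar> / m (snd q)) \<longlongrightarrow> \<bar>x - X (\<Xi> p, t)\<bar> / m t) ?F"
      using m(2)[OF xt(2)] by (intro tendsto_intros fst mt) auto
    then have lim: "((\<lambda>q. \<bar>fst q - X (\<Xi> p, snd q)\<bar> / m (snd q)) \<longlongrightarrow> 0) ?F"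
      using X\<Xi>[OF xt(2)] xt(1) by simp
    have "norm (\<Xi> q - \<Xi> p) \<le> \<bar>fst q - X (\<Xi> p, snd q)\<bar> / m (snd q)" if "q \<in> UNIV \<times> I" for q
      using expand_abs[of "snd q" "\<Xi> q" "\<Xi> p"] X\<Xi>[of "snd q" "fst q"] m(2)[of "snd q"] that
      by (auto simp: field_simps)
    then have "((\<lambda>q. \<Xi> q - \<Xi> p) \<longlongrightarrow> 0) ?F"
      using ev by (intro Lim_null_comparison[OF _ lim]) (auto elim: eventually_mono)
    then show "(\<Xi> \<longlongrightarrow> \<Xi> p) ?F"
      by (simp add: LIM_zero_iff)
  qed
  \<comment> \<open>Carrying time along turns the family of inverses into the inverse of the single
    map \<open>(X, snd)\<close>.\<close>
  define \<Psi> where "\<Psi> p = (\<Xi> p, snd p)" for p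
  have J0: "J p \<noteq> 0" if "p \<in> UNIV \<times> I" for p
    using m(2)[of "snd p"] m(3)[of "snd p" "fst p"] that by auto
  have \<Psi>I: "\<Psi> p \<in> UNIV \<times> I" if "p \<in> UNIV \<times> I" for p
    using that by (auto simp: \<Psi>_def)
  \<comment> \<open>First component of the inverse of the triangular derivative with rows
    \<open>(J, U)\<close> and \<open>(0, 1)\<close>, evaluated at \<open>\<Psi> p\<close>.\<close>
  let ?D = "\<lambda>p h. (fst h - U (\<Psi> p) * snd h) / J (\<Psi> p)"
  have d\<Psi>: "(\<Psi> has_derivative (\<lambda>h. (?D p h, snd h))) (at p within UNIV \<times> I)"
    if p: "p \<in> UNIV \<times> I" for p
  proof (rule has_derivative_inverse_within)
    show "((\<lambda>q. (X q, snd q)) has_derivative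
        (\<lambda>h. (J (\<Psi> p) * fst h + U (\<Psi> p) * snd h, snd h))) (at (\<Psi> p) within UNIV \<times> I)"
      by (intro has_derivative_Pair X \<Psi>I p has_derivative_snd has_derivative_ident)
    show "bounded_linear (\<lambda>h. (?D p h, snd h))"
      by (intro bounded_linear_Pair bounded_linear_snd
          bounded_linear_compose[OF bounded_linear_divide, of "\<lambda>h. fst h - U (\<Psi> p) * snd h"]
          bounded_linear_sub bounded_linear_fst bounded_linear_const_mult)
    show "continuous (at p within UNIV \<times> I) \<Psi>"
      using cont\<Xi> p unfolding \<Psi>_def continuous_on_eq_continuous_within
      by (intro continuous_intros) auto
    show "\<Psi> z \<in> UNIV \<times> I \<and> (X (\<Psi> z), snd (\<Psi> z)) = z" if "z \<in> UNIV \<times> I" for z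
      using that X\<Xi> by (auto simp: \<Psi>_def)
  qed (use p J0[OF \<Psi>I[OF p]] in auto)
  have d\<Xi>: "(\<Xi> has_derivative ?D p) (at p within UNIV \<times> I)" if "p \<in> UNIV \<times> I" for p
    using has_derivative_fst[OF d\<Psi>[OF that]] by (simp add: \<Psi>_def)
  have \<Xi>x: "((\<lambda>y. \<Xi> (y, t)) has_real_derivative 1 / J (\<Xi> (x, t), t)) (at x)" if "t \<in> I" for x t
    using partial_derivative_fst[OF d\<Xi> that, of x] that by (simp add: \<Psi>_def)
  have \<Xi>t: "((\<lambda>s. \<Xi> (x, s)) has_real_derivative - U (\<Xi> (x, t), t) / J (\<Xi> (x, t), t)) (at t within I)"
    if "t \<in> I" for x t
    using partial_derivative_snd[OF d\<Xi> that, of x] that by (simp add: \<Psi>_def)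
  \<comment> \<open>Bootstrapping: the derivative of \<open>\<Xi>\<close> is built from
    \<open>J\<close> and \<open>U\<close> composed with \<open>\<Psi>\<close>, hence is as regular
    as \<open>\<Xi>\<close> itself.\<close>
  have "Ck_on k \<Xi> (UNIV \<times> I)" for k
  proof (induction k)
    case 0
    show ?case using cont\<Xi> by simp
  next
    case (Suc k)
    have "Ck_on k \<Psi> (UNIV \<times> I)"
      unfolding \<Psi>_def by (intro Ck_on_Pair Suc.IH Ck_on_linear[OF bounded_linear_snd])
    then have "Ck_on k (\<lambda>p. ?D p h) (UNIV \<times> I)" for h
      using J U \<Psi>I J0 unfolding smooth_on_def
      by (intro Ck_on_divide Ck_on_diff Ck_on_mult Ck_on_const Ck_on_compose[of k J "UNIV \<times> I" \<Psi>]
          Ck_on_compose[of k U "UNIV \<times> I" \<Psi>]) auto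
    then show ?case using d\<Xi> by (auto intro!: exI[of _ ?D])
  qed
  then have smooth: "smooth_on (UNIV \<times> I) \<Xi>" by (simp add: smooth_on_def)
  have top: "filterlim (\<lambda>x. \<Xi> (x, t)) at_top at_top" if t: "t \<in> I" for t
    unfolding filterlim_at_top
  proof
    fix K
    have "K \<le> \<Xi> (x, t)" if "X (K, t) + 1 \<le> x" for x
      using mono[OF t, of "\<Xi> (x, t)" K] X\<Xi>[OF t, of x] that by linarith
    then show "\<forall>\<^sub>F x in at_top. K \<le> \<Xi> (x, t)"
      unfolding eventually_at_top_linorder by blast
  qed
  have bot: "filterlim (\<lambda>x. \<Xi> (x, t)) at_bot at_bot" if t: "t \<in> I" for t
    unfolding filterlim_at_bot
  proof
    fix K
    have "\<Xi> (x, t) \<le> K" if "x \<le> X (K, t) - 1" for x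
      using mono[OF t, of K "\<Xi> (x, t)"] X\<Xi>[OF t, of x] that by linarith
    then show "\<forall>\<^sub>F x in at_bot. \<Xi> (x, t) \<le> K"
      unfolding eventually_at_bot_linorder by blast
  qed
  show ?thesis
    by (rule that[OF smooth X\<Xi> \<Xi>X \<Xi>x \<Xi>t top bot])
qed

subsection \<open>Energy profile and linear equation\<close>

text \<open>\<open>Ck_on\<close> provides a derivative separately for each order; uniqueness of
  derivatives on the line identifies all of them with \<open>deriv F\<close>.\<close>

lemma smooth_on_deriv:
  fixes F :: "real \<Rightarrow> real"
  assumes "smooth_on UNIV F"
  shows "(F has_real_derivative deriv F x) (at x)" and "smooth_on UNIV (deriv F)"
proof -
  have "(\<forall>x. (F has_real_derivative deriv F x) (at x)) \<and> Ck_on k (deriv F) UNIV" for k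
  proof -
    have "Ck_on (Suc k) F UNIV"
      using assms unfolding smooth_on_def ..
    then obtain F' where "\<forall>x\<in>UNIV. (F has_derivative F' x) (at x)"
      and "\<forall>h. Ck_on k (\<lambda>x. F' x h) UNIV"
      unfolding Ck_on.simps by blast
    then have F': "\<And>x. (F has_derivative F' x) (at x)" "\<And>h. Ck_on k (\<lambda>x. F' x h) UNIV"
      by blast+
    have D: "(F has_real_derivative F' x 1) (at x)" for x
      by (rule has_derivative_imp_has_real_derivative[OF F'(1)])
    then have "deriv F = (\<lambda>x. F' x 1)"
      using DERIV_imp_deriv by blast
    then show ?thesis using D F'(2)[of 1] by simp
  qed
  then show "(F has_real_derivative deriv F x) (at x)" "smooth_on UNIV (deriv F)"
    unfolding smooth_on_def by blast+
qed

lemma smooth_on_has_real_derivative: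
  fixes f :: "real \<Rightarrow> real"
  assumes "smooth_on S f"
  obtains f' where "\<And>x. x \<in> S \<Longrightarrow> (f has_real_derivative f' x) (at x within S)"
proof -
  have "Ck_on (Suc 0) f S"
    using assms unfolding smooth_on_def ..
  then obtain f' where "\<forall>x\<in>S. (f has_derivative f' x) (at x within S)"
    unfolding Ck_on.simps by blast
  then show ?thesis
    by (intro that[of "\<lambda>x. f' x 1"] has_derivative_imp_has_real_derivative) simp
qed

text \<open>
  If \<open>S = 0\<close>, division by zero makes \<open>\<theta> = 0\<close>. The conclusions are multiplied by \<open>S\<close> so that they
  hold in this case as well.
\<close>

lemma normalized_energy:
  fixes f :: "real \<Rightarrow> real"
  assumes "smooth_on UNIV f" and "compact (closure {x. f x \<noteq> 0})"
    and S: "S = (LINT x|lborel. (f x)\<^sup>2)"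
  obtains \<theta> where "smooth_on UNIV \<theta>"
    and "\<And>x. (\<theta> has_real_derivative (f x)\<^sup>2 / S) (at x)"
    and "\<And>x. 0 \<le> \<theta> x" and "\<And>x. \<theta> x \<le> 1"
    and "\<And>x. (f x)\<^sup>2 = S * ((f x)\<^sup>2 / S)"
    and "\<forall>\<^sub>F x in at_top. S * (1 - \<theta> x) = 0" and "\<forall>\<^sub>F x in at_bot. S * \<theta> x = 0"
proof -
  have sm: "smooth_on UNIV (\<lambda>x. (f x)\<^sup>2)"
    using assms(1) by (auto simp: smooth_on_def intro: Ck_on_power)
  have cf: "continuous_on UNIV (\<lambda>x. (f x)\<^sup>2)"
    using sm Ck_on_continuous_on by (auto simp: smooth_on_def)
  have "bounded {x. f x \<noteq> 0}"
    using assms(2) by (meson bounded_subset closure_subset compact_imp_bounded)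
  then obtain R where R: "0 < R" "\<And>x. f x \<noteq> 0 \<Longrightarrow> \<bar>x\<bar> \<le> R"
    by (auto simp: bounded_pos)
  obtain s where s: "s (- R) = 0" "\<And>x. x \<in> UNIV \<Longrightarrow> (s has_real_derivative (f x)\<^sup>2) (at x)"
    using antiderivative_on_interval[OF is_interval_univ cf UNIV_I] by metis
  note s = s(1) s(2)[OF UNIV_I]
  have mono: "s x \<le> s y" if "x \<le> y" for x y
    using that by (rule DERIV_nonneg_imp_nondecreasing) (use s(2) zero_le_power2 in blast)
  have const: "s x = s y" if "x \<le> y" "y \<le> - R \<or> R \<le> x" for x y
  proof (cases "x = y")
    case False
    then obtain z where z: "x < z" "z < y" "s y - s x = (y - x) * (f z)\<^sup>2"
      using MVT2[of x y s "\<lambda>x. (f x)\<^sup>2"] s(2) \<open>x \<le> y\<close> by auto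
    then have "f z = 0" using R(2)[of z] that(2) by fastforce
    then show ?thesis using z(3) by simp
  qed simp
  \<comment> \<open>Inserting the indicator reduces the integral over the line to a compact
    interval, where the fundamental theorem applies.\<close>
  have "(\<lambda>x. (f x)\<^sup>2) = (\<lambda>x. (f x)\<^sup>2 * indicator {- R..R} x)"
    using R(2) by (fastforce simp: indicator_def)
  then have "S = (LINT x|lborel. (f x)\<^sup>2 * indicator {- R..R} x)"
    unfolding S by metis
  also have "\<dots> = s R - s (- R)"
    using R(1) s(2) cf continuous_on_eq_continuous_at[OF open_UNIV]
    by (intro integral_FTC_Icc_real) auto
  finally have SR: "S = s R" using s(1) by simp
  have s_bot: "s x = 0" if "x \<le> - R" for x using const[of x "- R"] that s(1) by simp
  have s_top: "s x = S" if "R \<le> x" for x using const[of R x] that SR by simp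
  have s_nn: "0 \<le> s x" and s_le: "s x \<le> S" for x
    using mono[of x "max x R"] mono[of "min x (- R)" x] s_top[of "max x R"] s_bot[of "min x (- R)"]
    by auto
  \<comment> \<open>If the total energy is 0, then \<open>s\<close> is squeezed to 0 and its
    derivative vanishes. This saves \<open>(f x)\<^sup>2 = S * ((f x)\<^sup>2 / S)\<close> when
    \<open>S = 0\<close>.\<close>
  have f0: "(f x)\<^sup>2 = 0" if "S = 0" for x
  proof -
    have "s = (\<lambda>x. 0)" using s_nn s_le that by (metis antisym ext)
    then show ?thesis using s(2)[of x] DERIV_unique DERIV_const by metis
  qed
  show ?thesis
  proof (rule that[of "\<lambda>x. s x / S"])
    show d: "((\<lambda>x. s x / S) has_real_derivative (f x)\<^sup>2 / S) (at x)" for x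
      by (rule DERIV_cdivide[OF s(2)])
    show "smooth_on UNIV (\<lambda>x. s x / S)"
    proof (rule smooth_on_antiderivative)
      show "((\<lambda>x. s x / S) has_real_derivative (f x)\<^sup>2 / S) (at x)" for x by (rule d)
      show "smooth_on UNIV (\<lambda>x. (f x)\<^sup>2 / S)"
        using sm unfolding smooth_on_def divide_inverse by (auto intro: Ck_on_mult Ck_on_const)
    qed
    show "0 \<le> s x / S" "s x / S \<le> 1" for x
      using s_nn[of x] s_le[of x] by (auto simp: divide_le_eq_1)
    show "(f x)\<^sup>2 = S * ((f x)\<^sup>2 / S)" for x using f0 by auto
    show "\<forall>\<^sub>F x in at_top. S * (1 - s x / S) = 0"
      using s_top by (intro eventually_at_top_linorderI[of R]) auto
    show "\<forall>\<^sub>F x in at_bot. S * (s x / S) = 0"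
      using s_bot unfolding eventually_at_bot_linorder by auto
  qed
qed

text \<open>The Riccati substitution \<open>\<sigma> = 2 y' / y\<close>, which turns
  \<open>\<sigma>' + \<sigma>\<^sup>2 / 2\<close> into \<open>2 y'' / y\<close>.\<close>

lemma exponential_factor:
  fixes \<sigma> :: "real \<Rightarrow> real"
  assumes "is_interval I" "0 \<in> I" "smooth_on I \<sigma>"
  obtains y where "y 0 = 1" "\<And>t. 0 < y t" "smooth_on I y"
    and "\<And>t. t \<in> I \<Longrightarrow> (y has_real_derivative \<sigma> t * y t / 2) (at t within I)"
proof -
  have "continuous_on I \<sigma>"
    using assms(3) Ck_on_continuous_on by (auto simp: smooth_on_def)
  then obtain A where A: "A 0 = 0" "\<And>t. t \<in> I \<Longrightarrow> (A has_real_derivative \<sigma> t) (at t within I)"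
    using antiderivative_on_interval[OF assms(1) _ assms(2)] by blast
  have "smooth_on I A"
    using A(2) assms(3) by (rule smooth_on_antiderivative)
  show ?thesis
  proof (rule that[of "\<lambda>t. exp (A t / 2)"])
    show "exp (A 0 / 2) = 1" "0 < exp (A t / 2)" for t using A(1) by auto
    show "smooth_on I (\<lambda>t. exp (A t / 2))"
      using \<open>smooth_on I A\<close> unfolding smooth_on_def
      by (intro allI Ck_on_compose[OF Ck_on_exp[of _ UNIV]] Ck_on_divide Ck_on_const) auto
    show "((\<lambda>t. exp (A t / 2)) has_real_derivative \<sigma> t * exp (A t / 2) / 2) (at t within I)"
      if "t \<in> I" for t
      using A(2)[OF that] by (auto intro!: derivative_eq_intros)
  qed
qed

text \<open>The quantity is twice the Wronskian \<open>a b' - a' b\<close>. Its derivative is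
  \<open>a b\<close> times the difference of the two sides of \<open>eq\<close>.\<close>

lemma wronskian_constant:
  fixes \<sigma>p \<sigma>m a b :: "real \<Rightarrow> real"
  assumes I: "is_interval I" "0 \<in> I" "t \<in> I"
    and a: "\<And>t. t \<in> I \<Longrightarrow> (a has_real_derivative \<sigma>m t * a t / 2) (at t within I)"
    and b: "\<And>t. t \<in> I \<Longrightarrow> (b has_real_derivative \<sigma>p t * b t / 2) (at t within I)"
    and p: "\<And>t. t \<in> I \<Longrightarrow> (\<sigma>p has_real_derivative p' t) (at t within I)"
    and m: "\<And>t. t \<in> I \<Longrightarrow> (\<sigma>m has_real_derivative m' t) (at t within I)"
    and eq: "\<And>t. t \<in> I \<Longrightarrow> p' t + (\<sigma>p t)\<^sup>2 / 2 = m' t + (\<sigma>m t)\<^sup>2 / 2"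
  shows "a t * b t * (\<sigma>p t - \<sigma>m t) = a 0 * b 0 * (\<sigma>p 0 - \<sigma>m 0)"
proof -
  have "((\<lambda>t. a t * b t * (\<sigma>p t - \<sigma>m t)) has_real_derivative 0) (at t within I)" if "t \<in> I" for t
  proof -
    have "((\<lambda>t. a t * b t * (\<sigma>p t - \<sigma>m t)) has_real_derivative
        (\<sigma>m t * a t / 2 * b t + \<sigma>p t * b t / 2 * a t) * (\<sigma>p t - \<sigma>m t)
          + (p' t - m' t) * (a t * b t)) (at t within I)"
      by (rule DERIV_mult DERIV_diff a b p m that)+
    moreover have "(\<sigma>m t * a t / 2 * b t + \<sigma>p t * b t / 2 * a t) * (\<sigma>p t - \<sigma>m t)
          + (p' t - m' t) * (a t * b t)
      = a t * b t * ((p' t + (\<sigma>p t)\<^sup>2 / 2) - (m' t + (\<sigma>m t)\<^sup>2 / 2))"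
      by (simp add: field_simps power2_eq_square)
    ultimately show ?thesis using eq[OF that] by simp
  qed
  from has_field_derivative_zero_constant[OF is_interval_convex[OF I(1)] this]
  obtain c where "\<forall>t\<in>I. a t * b t * (\<sigma>p t - \<sigma>m t) = c" by blast
  then show ?thesis using I(2,3) by simp
qed

subsection \<open>The solution\<close>

lemma is_interval_time_interval: "is_interval (time_interval T)"
  unfolding is_interval_1 time_interval_def
  by (metis (mono_tags, lifting) ereal_less_eq(3) mem_Collect_eq order_le_less_trans order_trans)

text \<open>\<open>vector_derivative\<close> is defined by choice and is determined only at limit
  points. Every point of \<open>[0, T)\<close> has room to its right.\<close>

lemma at_within_time_interval_neq_bot:
  assumes "t \<in> time_interval T"
  shows "at t within time_interval T \<noteq> bot"
proof -
  obtain b where b: "t < b" "ereal b < T"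
    using assms ereal_dense2[of "ereal t" T] unfolding time_interval_def
    by (metis (no_types, lifting) less_ereal.simps(1) mem_Collect_eq)
  have "t islimpt {t<..<b}"
    using b(1) by (simp add: islimpt_greaterThanLessThan1)
  moreover have "{t<..<b} \<subseteq> time_interval T"
    using assms b(2) order_less_trans[of "ereal _" "ereal b" T] by (force simp: time_interval_def)
  ultimately show ?thesis
    by (metis islimpt_subset trivial_limit_within)
qed

lemma ddt_eq:
  assumes "t \<in> time_interval T" "(f has_real_derivative D) (at t within time_interval T)"
  shows "ddt T f t = D"
  unfolding ddt_def using assms at_within_time_interval_neq_bot
  by (intro vector_derivative_within) (auto simp: has_real_derivative_iff_has_vector_derivative)

theorem proposition3:
  fixes F \<sigma>p \<sigma>m :: "real \<Rightarrow> real" and T :: ereal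
  assumes "smooth_on UNIV F"
    and "compact (closure {x. deriv F x \<noteq> 0})"
    and "0 < T"
    and "smooth_on (time_interval T) \<sigma>p"
    and "smooth_on (time_interval T) \<sigma>m"
    and "\<forall>t\<in>time_interval T.
           ddt T \<sigma>p t + 1/2 * (\<sigma>p t)\<^sup>2 = ddt T \<sigma>m t + 1/2 * (\<sigma>m t)\<^sup>2"
    and "\<sigma>p 0 - \<sigma>m 0 = (LINT x|lborel. (deriv F x)\<^sup>2)"
  shows "\<exists>u v :: real \<Rightarrow> real \<Rightarrow> real.
           smooth_on (UNIV \<times> time_interval T) (\<lambda>(x, t). u x t) \<and>
           smooth_on (UNIV \<times> time_interval T) (\<lambda>(x, t). v x t) \<and>
           (\<forall>x. \<forall>t\<in>time_interval T.
              dx (\<lambda>x t. dt T v x t + u x t * dx v x t) x t = 0 \<and>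
              dx (dx u) x t = (dx v x t)\<^sup>2) \<and>
           (\<forall>x. v x 0 = F x) \<and>
           (\<forall>t\<in>time_interval T.
              ((\<lambda>x. dx u x t) \<longlongrightarrow> \<sigma>p t) at_top \<and>
              ((\<lambda>x. dx u x t) \<longlongrightarrow> \<sigma>m t) at_bot)"
proof -
  define I where "I = time_interval T"
  \<comment> \<open>By the compatibility condition this is the total energy of \<open>F\<close>. As
    \<open>a\<close> and \<open>b\<close> start at 1, it is also the constant value of
    \<open>a b (\<sigma>p - \<sigma>m)\<close>.\<close>
  define S where "S = \<sigma>p 0 - \<sigma>m 0"
  define f where "f = deriv F"
  have I: "is_interval I" "0 \<in> I"
    using assms(3) is_interval_time_interval by (auto simp: I_def time_interval_def zero_ereal_def[symmetric])
  have F': "\<And>x. (F has_real_derivative f x) (at x)" and smf: "smooth_on UNIV f"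
    using smooth_on_deriv[OF assms(1)] by (auto simp: f_def)
  obtain \<theta> where \<theta>: "smooth_on UNIV \<theta>" "\<And>x. (\<theta> has_real_derivative (f x)\<^sup>2 / S) (at x)"
    "\<And>x. 0 \<le> \<theta> x" "\<And>x. \<theta> x \<le> 1" "\<And>x. (f x)\<^sup>2 = S * ((f x)\<^sup>2 / S)"
    "\<forall>\<^sub>F x in at_top. S * (1 - \<theta> x) = 0" "\<forall>\<^sub>F x in at_bot. S * \<theta> x = 0"
    using normalized_energy[OF smf assms(2,7)[folded f_def S_def]] by blast
  obtain a where a: "a 0 = 1" "\<And>t. 0 < a t" "smooth_on I a"
    "\<And>t. t \<in> I \<Longrightarrow> (a has_real_derivative \<sigma>m t * a t / 2) (at t within I)"
    using exponential_factor[OF I assms(5)[folded I_def]] by blast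
  obtain b where b: "b 0 = 1" "\<And>t. 0 < b t" "smooth_on I b"
    "\<And>t. t \<in> I \<Longrightarrow> (b has_real_derivative \<sigma>p t * b t / 2) (at t within I)"
    using exponential_factor[OF I assms(4)[folded I_def]] by blast
  obtain p' where p': "\<And>t. t \<in> I \<Longrightarrow> (\<sigma>p has_real_derivative p' t) (at t within I)"
    using smooth_on_has_real_derivative[OF assms(4), folded I_def] by blast
  obtain m' where m': "\<And>t. t \<in> I \<Longrightarrow> (\<sigma>m has_real_derivative m' t) (at t within I)"
    using smooth_on_has_real_derivative[OF assms(5), folded I_def] by blast
  have wronskian: "a t * b t * (\<sigma>p t - \<sigma>m t) = S" if t: "t \<in> I" for t
  proof -
    have "p' t + (\<sigma>p t)\<^sup>2 / 2 = m' t + (\<sigma>m t)\<^sup>2 / 2" if "t \<in> I" for t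
      using assms(6) ddt_eq[of t T \<sigma>p] ddt_eq[of t T \<sigma>m] p'[OF that] m'[OF that] that
      by (auto simp: I_def)
    then show ?thesis
      using wronskian_constant[OF I t a(4) b(4) p' m'] a(1) b(1) by (simp add: S_def)
  qed
  have cont\<theta>: "continuous_on UNIV \<theta>" "continuous_on UNIV (\<lambda>x. (\<theta> x)\<^sup>2)"
    using \<theta>(1) Ck_on_continuous_on by (auto simp: smooth_on_def intro!: continuous_intros)
  \<comment> \<open>The base points of \<open>P\<close> and \<open>Q\<close> can be left open: in
    \<open>X\<close> both carry a factor \<open>d\<close>, which vanishes at \<open>t = 0\<close>,
    so \<open>X (\<xi>, 0) = \<xi>\<close> in any case.\<close>
  obtain P where P: "\<And>x. x \<in> UNIV \<Longrightarrow> (P has_real_derivative \<theta> x) (at x)"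
    using antiderivative_on_interval[OF is_interval_univ cont\<theta>(1) UNIV_I] by metis
  note P = P[OF UNIV_I]
  obtain Q where Q: "\<And>x. x \<in> UNIV \<Longrightarrow> (Q has_real_derivative (\<theta> x)\<^sup>2) (at x)"
    using antiderivative_on_interval[OF is_interval_univ cont\<theta>(2) UNIV_I] by metis
  note Q = Q[OF UNIV_I]
  have smPQ: "smooth_on UNIV P" "smooth_on UNIV Q"
    by (rule smooth_on_antiderivative, rule P, rule \<theta>(1))
      (rule smooth_on_antiderivative, rule Q, use \<theta>(1) in \<open>simp add: smooth_on_def Ck_on_power\<close>)

  \<comment> \<open>The characteristic map and its inverse\<close>
  define a' where "a' t = \<sigma>m t * a t / 2" for t
  define d where "d t = b t - a t" for t
  define d' where "d' t = \<sigma>p t * b t / 2 - \<sigma>m t * a t / 2" for t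
  have a't: "\<And>t. t \<in> I \<Longrightarrow> (a has_real_derivative a' t) (at t within I)"
    and d't: "\<And>t. t \<in> I \<Longrightarrow> (d has_real_derivative d' t) (at t within I)"
    using a(4) b(4) by (auto simp: a'_def d_def[abs_def] d'_def intro!: derivative_intros)
  define y where "y \<xi> t = a t + \<theta> \<xi> * d t" for \<xi> t
  define y' where "y' \<xi> t = a' t + \<theta> \<xi> * d' t" for \<xi> t
  \<comment> \<open>\<open>X\<close> is the antiderivative in \<open>\<xi>\<close> of \<open>J = (a + \<theta> d)\<^sup>2\<close>, expanded so that the variables separate.\<close>
  define X where "X = (\<lambda>p. fst p * (a (snd p))\<^sup>2 + 2 * P (fst p) * (a (snd p) * d (snd p))
      + Q (fst p) * (d (snd p))\<^sup>2)"
  define J where "J = (\<lambda>p. (y (fst p) (snd p))\<^sup>2)"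
  \<comment> \<open>The time derivative of \<open>X\<close> at a fixed label, that is, the velocity
    along a characteristic.\<close>
  define U where "U = (\<lambda>p. fst p * (2 * a (snd p) * a' (snd p))
      + 2 * P (fst p) * (a' (snd p) * d (snd p) + a (snd p) * d' (snd p))
      + Q (fst p) * (2 * d (snd p) * d' (snd p)))"
  \<comment> \<open>This bound is uniform in \<open>\<xi>\<close>; its square becomes the function
    \<open>m\<close> of \<open>parametric_inverse\<close>.\<close>
  have y_ge: "min (a t) (b t) \<le> y \<xi> t" for \<xi> t
  proof -
    have "y \<xi> t = (1 - \<theta> \<xi>) * a t + \<theta> \<xi> * b t" by (simp add: y_def d_def algebra_simps)
    moreover have "(1 - \<theta> \<xi>) * min (a t) (b t) + \<theta> \<xi> * min (a t) (b t)
        \<le> (1 - \<theta> \<xi>) * a t + \<theta> \<xi> * b t"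
      using \<theta>(3,4)[of \<xi>] by (intro add_mono mult_left_mono) auto
    ultimately show ?thesis by (simp add: algebra_simps)
  qed
  have y_pos: "0 < y \<xi> t" for \<xi> t
    using y_ge[of t \<xi>] a(2)[of t] b(2)[of t] by auto
  have Ck_fst: "Ck_on k (\<lambda>p. h (fst p)) (UNIV \<times> I)" if "smooth_on UNIV h"
    for k and h :: "real \<Rightarrow> real"
    using that unfolding smooth_on_def
    by (intro Ck_on_compose[OF _ Ck_on_linear[OF bounded_linear_fst], of k h UNIV]) auto
  have Ck_snd: "Ck_on k (\<lambda>p. h (snd p)) (UNIV \<times> I)" if "smooth_on I h"
    for k and h :: "real \<Rightarrow> real"
    using that unfolding smooth_on_def
    by (intro Ck_on_compose[OF _ Ck_on_linear[OF bounded_linear_snd], of k h I]) auto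
  have smt: "smooth_on I d" "smooth_on I a'" "smooth_on I d'"
    using a(3) b(3) assms(4,5)
    unfolding smooth_on_def I_def[symmetric] d_def[abs_def] a'_def[abs_def] d'_def[abs_def]
    by (auto intro!: Ck_on_diff Ck_on_divide Ck_on_mult Ck_on_const)
  note Ck = Ck_on_add Ck_on_mult Ck_on_power Ck_on_const Ck_fst Ck_snd smt smPQ \<theta>(1) a(3)
    Ck_on_linear[OF bounded_linear_fst]
  have smJ: "smooth_on (UNIV \<times> I) J" and smU: "smooth_on (UNIV \<times> I) U"
    unfolding smooth_on_def J_def U_def y_def by (intro allI Ck)+
  have dX: "(X has_derivative (\<lambda>h. J p * fst h + U p * snd h)) (at p within UNIV \<times> I)"
    if p: "p \<in> UNIV \<times> I" for p
  proof -
    have t: "snd p \<in> I" using p by auto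
    note D = has_derivative_fst_compose[OF P] has_derivative_fst_compose[OF Q]
      has_derivative_snd_compose[OF a't[OF t]] has_derivative_snd_compose[OF d't[OF t]]
    show ?thesis
      unfolding X_def
      by (rule derivative_eq_intros D refl)+
        (simp add: J_def U_def y_def fun_eq_iff algebra_simps power2_eq_square)
  qed
  have contm: "continuous_on I (\<lambda>t. (min (a t) (b t))\<^sup>2)"
    using a(3) b(3) unfolding smooth_on_def
    by (intro continuous_intros) (rule Ck_on_continuous_on[of 0], blast)+
  have m_pos: "0 < (min (a t) (b t))\<^sup>2" and m_le: "(min (a t) (b t))\<^sup>2 \<le> J (\<xi>, t)" for \<xi> t
    using a(2)[of t] b(2)[of t] power_mono[OF y_ge[of t \<xi>], of 2] by (auto simp: J_def min_def)
  obtain \<Xi> where sm\<Xi>: "smooth_on (UNIV \<times> I) \<Xi>"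
    and X\<Xi>: "\<And>x t. t \<in> I \<Longrightarrow> X (\<Xi> (x, t), t) = x"
    and \<Xi>X: "\<And>x t. t \<in> I \<Longrightarrow> \<Xi> (X (x, t), t) = x"
    and \<Xi>x: "\<And>x t. t \<in> I \<Longrightarrow> ((\<lambda>y. \<Xi> (y, t)) has_real_derivative 1 / J (\<Xi> (x, t), t)) (at x)"
    and \<Xi>t: "\<And>x t. t \<in> I \<Longrightarrow> ((\<lambda>s. \<Xi> (x, s)) has_real_derivative
            - U (\<Xi> (x, t), t) / J (\<Xi> (x, t), t)) (at t within I)"
    and \<Xi>top: "\<And>t. t \<in> I \<Longrightarrow> filterlim (\<lambda>x. \<Xi> (x, t)) at_top at_top"
    and \<Xi>bot: "\<And>t. t \<in> I \<Longrightarrow> filterlim (\<lambda>x. \<Xi> (x, t)) at_bot at_bot"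
    using parametric_inverse[OF dX smJ smU contm m_pos m_le] by blast
  have J_pos: "0 < J q" for q using y_pos[of "fst q" "snd q"] by (simp add: J_def)

  \<comment> \<open>The solution and its two equations\<close>
  define u where "u x t = U (\<Xi> (x, t), t)" for x t
  define v where "v x t = F (\<Xi> (x, t))" for x t
  \<comment> \<open>This is \<open>u\<^sub>x\<close> as a function of the label:
    \<open>U\<^sub>\<xi> / J = 2 y y' / y\<^sup>2\<close>.\<close>
  define g where "g \<xi> t = 2 * y' \<xi> t / y \<xi> t" for \<xi> t
  have sm\<Psi>: "Ck_on k (\<lambda>p. (\<Xi> p, snd p)) (UNIV \<times> I)" for k
    using sm\<Xi> unfolding smooth_on_def by (intro Ck_on_Pair Ck_on_linear[OF bounded_linear_snd]) auto
  have smu: "smooth_on (UNIV \<times> I) (\<lambda>(x, t). u x t)"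
    unfolding smooth_on_def
  proof
    fix k
    have "Ck_on k (\<lambda>p. U (\<Xi> p, snd p)) (UNIV \<times> I)"
      by (rule Ck_on_compose[OF smU[unfolded smooth_on_def, rule_format] sm\<Psi>]) auto
    then show "Ck_on k (\<lambda>(x, t). u x t) (UNIV \<times> I)"
      by (rule Ck_on_cong) (auto simp: u_def)
  qed
  have smv: "smooth_on (UNIV \<times> I) (\<lambda>(x, t). v x t)"
    unfolding smooth_on_def
  proof
    fix k
    have "Ck_on k (\<lambda>p. F (\<Xi> p)) (UNIV \<times> I)"
      by (rule Ck_on_compose[OF assms(1)[unfolded smooth_on_def, rule_format]
          sm\<Xi>[unfolded smooth_on_def, rule_format] UNIV_I])
    then show "Ck_on k (\<lambda>(x, t). v x t) (UNIV \<times> I)"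
      by (rule Ck_on_cong) (auto simp: v_def)
  qed
  have dxv: "dx v x t = f (\<Xi> (x, t)) / J (\<Xi> (x, t), t)" if "t \<in> I" for x t
    unfolding dx_def v_def using DERIV_chain2[OF F' \<Xi>x[OF that]] by (intro DERIV_imp_deriv) simp
  have dtv: "dt T v x t = f (\<Xi> (x, t)) * (- U (\<Xi> (x, t), t) / J (\<Xi> (x, t), t))" if "t \<in> I" for x t
    unfolding dt_def using that DERIV_chain2[OF F' \<Xi>t[OF that]]
    by (intro ddt_eq) (auto simp: I_def v_def[abs_def])
  \<comment> \<open>The first equation holds even before the outer derivative in \<open>x\<close>:
    the terms \<open>- f U / J\<close> and \<open>U f / J\<close> cancel.\<close>
  have transport: "dt T v x t + u x t * dx v x t = 0" if "t \<in> I" for x t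
    by (simp add: dxv[OF that] dtv[OF that] u_def)
  have dxu: "dx u x t = g (\<Xi> (x, t)) t" if "t \<in> I" for x t
  proof -
    have "((\<lambda>\<xi>. U (\<xi>, t)) has_real_derivative 2 * y \<xi> t * y' \<xi> t) (at \<xi>)" for \<xi>
      unfolding U_def fst_conv snd_conv
      by (rule derivative_eq_intros P Q refl)+
        (simp add: y_def y'_def algebra_simps power2_eq_square)
    from DERIV_chain2[OF this \<Xi>x[OF that]]
    have "dx u x t = 2 * y (\<Xi> (x, t)) t * y' (\<Xi> (x, t)) t * (1 / J (\<Xi> (x, t), t))"
      unfolding dx_def u_def by (intro DERIV_imp_deriv)
    also have "\<dots> = g (\<Xi> (x, t)) t"
      using y_pos[of "\<Xi> (x, t)" t] by (simp add: g_def J_def power2_eq_square)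
    finally show ?thesis .
  qed
  have dxdxu: "dx (dx u) x t = (dx v x t)\<^sup>2" if t: "t \<in> I" for x t
  proof -
    have g\<xi>: "((\<lambda>\<xi>. g \<xi> t) has_real_derivative (f \<xi>)\<^sup>2 / J (\<xi>, t)) (at \<xi>)" for \<xi>
    proof -
      define \<theta>' where "\<theta>' = (f \<xi>)\<^sup>2 / S"
      have "((\<lambda>\<xi>. y \<xi> t) has_real_derivative \<theta>' * d t) (at \<xi>)"
        "((\<lambda>\<xi>. 2 * y' \<xi> t) has_real_derivative 2 * (\<theta>' * d' t)) (at \<xi>)"
        unfolding y_def y'_def \<theta>'_def using \<theta>(2) by (auto intro!: derivative_eq_intros)
      then have "((\<lambda>\<xi>. g \<xi> t) has_real_derivative
          (2 * (\<theta>' * d' t) * y \<xi> t - 2 * y' \<xi> t * (\<theta>' * d t)) / (y \<xi> t * y \<xi> t)) (at \<xi>)"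
        unfolding g_def using y_pos[of \<xi> t] by (intro DERIV_divide) auto
      \<comment> \<open>The terms quadratic in the energy profile cancel, leaving
        \<open>2 \<theta>' (a d' - a' d)\<close>. Since \<open>d = b - a\<close>, this is
        \<open>2 \<theta>'\<close> times the Wronskian of \<open>a\<close> and
        \<open>b\<close>.\<close>
      moreover have "2 * (\<theta>' * d' t) * y \<xi> t - 2 * y' \<xi> t * (\<theta>' * d t)
          = \<theta>' * (a t * b t * (\<sigma>p t - \<sigma>m t))"
        by (simp add: y_def y'_def d_def d'_def a'_def algebra_simps)
      moreover have "\<dots> = (f \<xi>)\<^sup>2"
        using wronskian[OF t] \<theta>(5)[of \<xi>] by (simp add: \<theta>'_def mult.commute)
      ultimately show ?thesis by (simp add: J_def power2_eq_square)
    qed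
    have "dx (dx u) x t = deriv (\<lambda>x. g (\<Xi> (x, t)) t) x"
      using dxu[OF t] by (simp add: dx_def[of "dx u"])
    also have "\<dots> = (f (\<Xi> (x, t)))\<^sup>2 / J (\<Xi> (x, t), t) * (1 / J (\<Xi> (x, t), t))"
      using DERIV_chain2[OF g\<xi> \<Xi>x[OF t]] by (rule DERIV_imp_deriv)
    also have "\<dots> = (dx v x t)\<^sup>2"
      by (simp add: dxv[OF t] power2_eq_square)
    finally show ?thesis .
  qed

  \<comment> \<open>Initial and boundary values\<close>
  have init: "v x 0 = F x" for x
  proof -
    have "X (x, 0) = x" by (simp add: X_def a(1) b(1) d_def)
    then show ?thesis using \<Xi>X[OF I(2), of x] by (simp add: v_def)
  qed
  have top: "((\<lambda>x. dx u x t) \<longlongrightarrow> \<sigma>p t) at_top" if t: "t \<in> I" for t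
  proof (rule tendsto_eventually)
    \<comment> \<open>The boundary value is attained exactly for large \<open>x\<close>. If
      \<open>S\<close> is nonzero, then \<open>\<theta> \<xi> = 1\<close> and \<open>y\<close>
      equals \<open>b\<close>; if \<open>S = 0\<close>, the Wronskian identity forces
      \<open>\<sigma>p t = \<sigma>m t\<close>. Keeping the factor \<open>S\<close> treats both
      cases at once.\<close>
    have *: "g \<xi> t = \<sigma>p t" if "S * (1 - \<theta> \<xi>) = 0" for \<xi>
    proof -
      have "b t * (2 * y' \<xi> t - \<sigma>p t * y \<xi> t) = - (a t * b t * (\<sigma>p t - \<sigma>m t)) * (1 - \<theta> \<xi>)"
        by (simp add: y_def y'_def d_def d'_def a'_def algebra_simps)
      then have "2 * y' \<xi> t = \<sigma>p t * y \<xi> t"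
        using wronskian[OF t] that b(2)[of t] by simp
      then show ?thesis using y_pos[of \<xi> t] by (simp add: g_def)
    qed
    show "\<forall>\<^sub>F x in at_top. dx u x t = \<sigma>p t"
      using eventually_compose_filterlim[OF \<theta>(6) \<Xi>top[OF t]]
      by eventually_elim (simp add: dxu[OF t] *)
  qed
  have bot: "((\<lambda>x. dx u x t) \<longlongrightarrow> \<sigma>m t) at_bot" if t: "t \<in> I" for t
  proof (rule tendsto_eventually)
    have *: "g \<xi> t = \<sigma>m t" if "S * \<theta> \<xi> = 0" for \<xi>
    proof -
      have "a t * (2 * y' \<xi> t - \<sigma>m t * y \<xi> t) = (a t * b t * (\<sigma>p t - \<sigma>m t)) * \<theta> \<xi>"
        by (simp add: y_def y'_def d_def d'_def a'_def algebra_simps)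
      then have "2 * y' \<xi> t = \<sigma>m t * y \<xi> t"
        using wronskian[OF t] that a(2)[of t] by simp
      then show ?thesis using y_pos[of \<xi> t] by (simp add: g_def)
    qed
    show "\<forall>\<^sub>F x in at_bot. dx u x t = \<sigma>m t"
      using eventually_compose_filterlim[OF \<theta>(7) \<Xi>bot[OF t]]
      by eventually_elim (simp add: dxu[OF t] *)
  qed
  have "dx (\<lambda>x t. dt T v x t + u x t * dx v x t) x t = 0" if "t \<in> I" for x t
    unfolding dx_def[of "\<lambda>x t. dt T v x t + u x t * dx v x t"] transport[OF that] by simp
  then show ?thesis
    using smu smv dxdxu init top bot unfolding I_def by blast
qed

end
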